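(* Let $(\mathbb{X},\mathbb{0},\mathbb{1},\oplus,\otimes)$ be an idempotent semifield with real powers (as specified in the context), let $n\ge 1$, and let $A=(a_{ij})\in\mathbb{X}^{n\times n}$ be an irreducible matrix with an eigenvalue $\lambda$. Suppose that $\boldsymbol{u}=(u_i)$ and $\boldsymbol{v}=(v_i)$ are eigenvectors of the matrices $A$ and $A^{T}$, respectively. Then $$ \min_{\boldsymbol{x}\in\mathbb{X}_{+}^{n}}\boldsymbol{x}^{-}A\boldsymbol{x}=\lambda, $$ and the minimum is attained at every vector $\boldsymbol{x}=(u_1^{\alpha}v_1^{\alpha-1},\ldots,u_n^{\alpha}v_n^{\alpha-1})^{T}$ with $0\le\alpha\le 1$ ($\alpha$ real).
   Context: Idempotent semifield: $(\mathbb{X},\mathbb{0},\mathbb{1},\oplus,\otimes)$ is a commutative semiring with zero $\mathbb{0}$ and identity $\mathbb{1}$, in which addition is idempotent ($x\oplus x=x$) and every element of $\mathbb{X}_{+}=\mathbb{X}\setminus\{\mathbb{0}\}$ has a multiplicative inverse. The sign $\otimes$ is omitted, and all powers are in the sense of $\otimes$: $x^0=\mathbb{1}$, $x^p=x^{p-1}x$, $x^{-p}=(x^{-1})^p$ for $x\in\mathbb{X}_+$ and integer $p>0$, and $\mathbb{0}^p=\mathbb{0}$ for $p>0$. Real powers: it is assumed that integer powers extend to real exponents. That is, $x^{\alpha}\in\mathbb{X}_+$ is defined for all $x\in\mathbb{X}_+$ and $\alpha\in\mathbb{R}$, extends integer powers, and satisfies the usual laws $x^{\alpha}x^{\beta}=x^{\alpha+\beta}$,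 $(x^{\alpha})^{\beta}=x^{\alpha\beta}$, $(xy)^{\alpha}=x^{\alpha}y^{\alpha}$. Also $\mathbb{0}^{\alpha}=\mathbb{0}$ for $\alpha>0$, and $(x\oplus y)^{\alpha}=x^{\alpha}\oplus y^{\alpha}$ for all $\alpha\ge 0$. Order: $x\le y$ if and only if $x\oplus y=y$. This is a partial order on $\mathbb{X}$, and inequalities and the minimum refer to it. Thus "$\min_{\boldsymbol{x}} f(\boldsymbol{x})=\lambda$" means that $f(\boldsymbol{x})\ge\lambda$ for all admissible $\boldsymbol{x}$ and equality holds for some $\boldsymbol{x}$. Vectors and matrices: sums and products of vectors and matrices over $\mathbb{X}$ are defined by the usual formulas with $\oplus,\otimes$ in place of $+,\cdot$; $A^T$ is the transpose. $\mathbb{X}_+^n$ is the set of column vectors with all entries nonzero ($\neq\mathbb{0}$). For $\boldsymbol{x}=(x_i)\in\mathbb{X}_+^n$, $\boldsymbol{x}^{-}$ denotes the row vector with entries $x_i^{-1}$; hence $\boldsymbol{x}^{-}A\boldsymbol{x}=\bigoplus_{i,j}x_i^{-1}a_{ij}x_j$. A square matrix is irreducible if it cannot be put in a block triangular form by simultaneous permutations of rows and columns. A scalar $\lambda\in\mathbb{X}$ is an eigenvalue of $A$ if $A\boldsymbol{x}=\lambda\boldsymbol{x}$ for some vector $\boldsymbol{x}\in\mathbb{X}^n$ that is not the zero vector; any such $\boldsymbol{x}$ is an eigenvector of $A$ corresponding to $\lambda$. Background fact: an irreducible matrix $A$ has exactly one eigenvalue, $\lambda=\bigoplus_{m=1}^{n}(\mathrm{tr}(A^m))^{1/m}$,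 where $\mathrm{tr}$ is the $\oplus$-sum of the diagonal entries, and its eigenvectors have no zero entries. In particular $A^T$ has the same eigenvalue $\lambda$, and $\boldsymbol{u},\boldsymbol{v}\in\mathbb{X}_+^n$. *)

theory Defs
  imports "HOL-Analysis.Analysis"
begin

text \<open>
  The symbols \<open>0\<close>, \<open>1\<close>, \<open>+\<close>, \<open>*\<close> and \<open>\<Sum>\<close> denote the idempotent operations. Neither
  \<open>inverse 0\<close> nor linearity of the order is specified.
\<close>

class idempotent_semifield = comm_semiring_1 + inverse + ord +
  assumes add_idem: "x + x = x"
    and left_inverse_nonzero: "x \<noteq> 0 \<Longrightarrow> inverse x * x = 1"
    and divide_conv_inverse: "x / y = x * inverse y"
    and le_iff_add_eq: "x \<le> y \<longleftrightarrow> x + y = y"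
    and less_iff_le_not_ge: "x < y \<longleftrightarrow> x \<le> y \<and> \<not> y \<le> x"
begin

subclass order
proof
  fix x y z :: 'a
  show "x < y \<longleftrightarrow> x \<le> y \<and> \<not> y \<le> x"
    by (rule less_iff_le_not_ge)
  show "x \<le> x"
    by (simp add: le_iff_add_eq add_idem)
  show "x \<le> z" if "x \<le> y" "y \<le> z"
    using that by (metis le_iff_add_eq add.assoc)
  show "x = y" if "x \<le> y" "y \<le> x"
    using that by (metis le_iff_add_eq add.commute)
qed

end

text \<open>
  Powers \<open>0\<^sup>\<alpha>\<close> with \<open>\<alpha> \<le> 0\<close> are left unspecified; this is why \<open>rpow_add_base\<close> is stated for nonzero
  arguments. For \<open>\<alpha> > 0\<close> its extension to zero arguments follows from \<open>zero_rpow\<close>.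
\<close>

class real_power_semifield = idempotent_semifield +
  fixes rpow :: "'a \<Rightarrow> real \<Rightarrow> 'a"  (infixr \<open>rpow\<close> 80)
  assumes rpow_nonzero: "x \<noteq> 0 \<Longrightarrow> x rpow \<alpha> \<noteq> 0"
    and rpow_of_nat: "x \<noteq> 0 \<Longrightarrow> x rpow (of_nat p) = x ^ p"
    and rpow_minus_of_nat: "x \<noteq> 0 \<Longrightarrow> x rpow (- of_nat p) = inverse x ^ p"
    and rpow_add: "x \<noteq> 0 \<Longrightarrow> x rpow (\<alpha> + \<beta>) = x rpow \<alpha> * x rpow \<beta>"
    and rpow_rpow: "x \<noteq> 0 \<Longrightarrow> (x rpow \<alpha>) rpow \<beta> = x rpow (\<alpha> * \<beta>)"
    and rpow_mult_base: "x \<noteq> 0 \<Longrightarrow> y \<noteq> 0 \<Longrightarrow> (x * y) rpow \<alpha> = x rpow \<alpha> * y rpow \<alpha>"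
    and zero_rpow: "\<alpha> > 0 \<Longrightarrow> 0 rpow \<alpha> = 0"
    and rpow_add_base:
      "x \<noteq> 0 \<Longrightarrow> y \<noteq> 0 \<Longrightarrow> \<alpha> \<ge> 0 \<Longrightarrow> (x + y) rpow \<alpha> = x rpow \<alpha> + y rpow \<alpha>"

definition nonzero_vectors :: "('a::zero ^ 'n) set"
  where "nonzero_vectors = {x. \<forall>i. x $ i \<noteq> 0}"

definition conj_transpose :: "'a::inverse ^ 'n \<Rightarrow> 'a ^ 'n"
  where "conj_transpose x = (\<chi> i. inverse (x $ i))"

text \<open>The scalar \<open>x\<^sup>- A x\<close>.\<close>

definition conj_form :: "('a::idempotent_semifield) ^ 'n ^ 'n \<Rightarrow> 'a ^ 'n \<Rightarrow> 'a"
  where "conj_form A x = scalar_product (conj_transpose x) (A *v x)"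

text \<open>
  An ordering \<open>\<pi>\<close> of the index type encodes a simultaneous permutation of rows and columns. The
  diagonal blocks have sizes \<open>k\<close> and \<open>CARD('n) - k\<close>. Which off-diagonal block vanishes is
  immaterial, since reversing \<open>\<pi>\<close> exchanges the two, and a form with more diagonal blocks is also
  one with two.
\<close>

definition block_triangular :: "nat \<Rightarrow> (nat \<Rightarrow> nat \<Rightarrow> 'a::zero) \<Rightarrow> bool"
  where "block_triangular n B \<longleftrightarrow>
    (\<exists>k. 0 < k \<and> k < n \<and> (\<forall>i j. k \<le> i \<and> i < n \<and> j < k \<longrightarrow> B i j = 0))"

definition irreducible_matrix :: "'a::zero ^ 'n ^ 'n \<Rightarrow> bool"
  where "irreducible_matrix A \<longleftrightarrow>
    \<not> (\<exists>\<pi>. bij_betw \<pi> {..<CARD('n)} (UNIV :: 'n set) \<and>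
          block_triangular CARD('n) (\<lambda>i j. A $ \<pi> i $ \<pi> j))"

definition eigenvector_for :: "('a::semiring_1) ^ 'n ^ 'n \<Rightarrow> 'a ^ 'n \<Rightarrow> 'a \<Rightarrow> bool"
  where "eigenvector_for A x lam \<longleftrightarrow> x \<noteq> 0 \<and> A *v x = lam *s x"

definition eigenvalue_of :: "('a::semiring_1) ^ 'n ^ 'n \<Rightarrow> 'a \<Rightarrow> bool"
  where "eigenvalue_of A lam \<longleftrightarrow> (\<exists>x. eigenvector_for A x lam)"

definition eigenvector_of :: "('a::semiring_1) ^ 'n ^ 'n \<Rightarrow> 'a ^ 'n \<Rightarrow> bool"
  where "eigenvector_of A x \<longleftrightarrow> (\<exists>lam. eigenvector_for A x lam)"

definition attains_at :: "('b \<Rightarrow> 'a) \<Rightarrow> 'b set \<Rightarrow> 'a \<Rightarrow> 'b \<Rightarrow> bool"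
  where "attains_at f S m x \<longleftrightarrow> x \<in> S \<and> f x = m"

text \<open>
  The least value with respect to a possibly partial order, hence not merely a minimal one.
\<close>

definition minimum_on :: "('b \<Rightarrow> 'a::order) \<Rightarrow> 'b set \<Rightarrow> 'a \<Rightarrow> bool"
  where "minimum_on f S m \<longleftrightarrow> (\<forall>x\<in>S. m \<le> f x) \<and> (\<exists>x. attains_at f S m x)"

end

theory Submission
  imports Defs
begin

text \<open>
  Put \<open>s = x\<^sup>- A x\<close>. Then \<open>A x \<le> s x\<close> entrywise, and multiplying by \<open>v\<^sup>T\<close> gives
  \<open>\<lambda> v\<^sup>T x \<le> s v\<^sup>T x\<close>, hence \<open>\<lambda> \<le> s\<close>. Conversely, with \<open>x\<^sub>i = u\<^sub>i\<^sup>\<alpha> v\<^sub>i\<^sup>\<alpha>\<^sup>-\<^sup>1\<close> each term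
  \<open>x\<^sub>i\<^sup>-\<^sup>1 a\<^sub>i\<^sub>j x\<^sub>j\<close> is a weighted geometric mean of \<open>u\<^sub>i\<^sup>-\<^sup>1 a\<^sub>i\<^sub>j u\<^sub>j \<le> \<lambda>\<close> and
  \<open>v\<^sub>i a\<^sub>i\<^sub>j v\<^sub>j\<^sup>-\<^sup>1 \<le> \<lambda>\<close>, so it is at most \<open>\<lambda>\<close>. Uniqueness of the eigenvalue comes from evaluating
  \<open>v\<^sup>T A w\<close> in two ways.
\<close>

section \<open>Order, suprema and cancellation in an idempotent semifield\<close>

lemma zero_le_idem: "0 \<le> (x::'a::idempotent_semifield)"
  by (simp add: le_iff_add_eq)

lemma le_zero_idem: "x \<le> 0 \<longleftrightarrow> x = (0::'a::idempotent_semifield)"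
  by (simp add: le_iff_add_eq)

lemma add_le_iff_idem: "x + y \<le> z \<longleftrightarrow> x \<le> z \<and> y \<le> (z::'a::idempotent_semifield)"
proof
  assume xyz: "x + y \<le> z"
  have "x \<le> x + y"
    by (simp add: le_iff_add_eq add_idem flip: add.assoc)
  moreover have "y \<le> x + y"
    by (simp add: le_iff_add_eq add_idem add.left_commute)
  ultimately show "x \<le> z \<and> y \<le> z"
    using xyz by (blast intro: order_trans)
qed (simp add: le_iff_add_eq add.assoc)

text \<open>A finite sum is the supremum of its terms, the empty sum because 0 is the least element.
  This replaces the choice of a largest term, which a partial order does not permit.\<close>

lemma sum_le_iff_idem:
  fixes f :: "'i \<Rightarrow> 'a::idempotent_semifield"
  assumes "finite I"
  shows "sum f I \<le> z \<longleftrightarrow> (\<forall>i\<in>I. f i \<le> z)"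
  using assms by (induction I rule: finite_induct) (auto simp: add_le_iff_idem zero_le_idem)

lemma member_le_sum_idem:
  fixes f :: "'i \<Rightarrow> 'a::idempotent_semifield"
  assumes "finite I" "i \<in> I"
  shows "f i \<le> sum f I"
  using assms sum_le_iff_idem[of I f "sum f I"] by auto

lemma mult_left_mono_idem: "x \<le> y \<Longrightarrow> z * x \<le> z * (y::'a::idempotent_semifield)"
  by (metis le_iff_add_eq distrib_left)

lemma mult_mono_idem:
  fixes x y z w :: "'a::idempotent_semifield"
  assumes "x \<le> y" "z \<le> w"
  shows "x * z \<le> y * w"
proof -
  have "x * z \<le> x * w"
    using assms by (intro mult_left_mono_idem)
  also have "\<dots> \<le> y * w"
    using mult_left_mono_idem[OF assms(1), of w] by (simp add: mult.commute)
  finally show ?thesis .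
qed

lemma right_inverse_idem: "(x::'a::idempotent_semifield) \<noteq> 0 \<Longrightarrow> x * inverse x = 1"
  by (metis left_inverse_nonzero mult.commute)

lemma inverse_nonzero_idem: "(x::'a::idempotent_semifield) \<noteq> 0 \<Longrightarrow> inverse x \<noteq> 0"
  by (metis left_inverse_nonzero mult_zero_left zero_neq_one)

lemma mult_eq_0_idem: "x * y = 0 \<longleftrightarrow> x = 0 \<or> y = (0::'a::idempotent_semifield)"
  by (metis left_inverse_nonzero mult.assoc mult_1 mult_zero_left mult_zero_right)

lemma mult_le_cancel_right_idem:
  fixes x y z :: "'a::idempotent_semifield"
  assumes "z \<noteq> 0"
  shows "x * z \<le> y * z \<longleftrightarrow> x \<le> y"
proof
  assume "x * z \<le> y * z"
  then have "x * z * inverse z \<le> y * z * inverse z"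
    by (rule mult_mono_idem[OF _ order_refl])
  then show "x \<le> y"
    using assms by (simp add: mult.assoc right_inverse_idem)
qed (auto intro: mult_mono_idem)

lemma mult_right_cancel_idem:
  fixes x y z :: "'a::idempotent_semifield"
  assumes "z \<noteq> 0"
  shows "x * z = y * z \<longleftrightarrow> x = y"
  by (metis assms mult_le_cancel_right_idem order_antisym order_refl)

lemma inverse_mult_le_iff_idem:
  fixes x y z :: "'a::idempotent_semifield"
  assumes "x \<noteq> 0"
  shows "inverse x * y \<le> z \<longleftrightarrow> y \<le> z * x"
proof -
  have "inverse x * y * x = y"
    using left_inverse_nonzero[OF assms] by (metis mult.assoc mult.commute mult_1)
  then show ?thesis
    using mult_le_cancel_right_idem[OF assms, of "inverse x * y" z] by simp
qed

section \<open>Real powers: monotonicity, inverses and weighted means\<close>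

lemma rpow_mono:
  fixes x y :: "'a::real_power_semifield"
  assumes "x \<noteq> 0" "y \<noteq> 0" "x \<le> y" "0 \<le> \<alpha>"
  shows "x rpow \<alpha> \<le> y rpow \<alpha>"
  by (metis assms le_iff_add_eq rpow_add_base)

lemma rpow_0: "(x::'a::real_power_semifield) \<noteq> 0 \<Longrightarrow> x rpow 0 = 1"
  using rpow_of_nat[of x 0] by simp

lemma rpow_1: "(x::'a::real_power_semifield) \<noteq> 0 \<Longrightarrow> x rpow 1 = x"
  using rpow_of_nat[of x 1] by simp

lemma rpow_minus_1: "(x::'a::real_power_semifield) \<noteq> 0 \<Longrightarrow> x rpow (- 1) = inverse x"
  using rpow_minus_of_nat[of x 1] by simp

text \<open>The axioms tie negative powers to \<open>inverse\<close> only for integer exponents;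
  factoring the exponent as -1 times \<open>\<alpha>\<close> carries this over to real ones.\<close>

lemma rpow_minus:
  fixes x :: "'a::real_power_semifield"
  assumes "x \<noteq> 0"
  shows "x rpow (- \<alpha>) = inverse x rpow \<alpha>"
  using rpow_rpow[OF assms, of "- 1" \<alpha>] assms by (simp add: rpow_minus_1)

lemma weighted_mean_le:
  fixes p q c :: "'a::real_power_semifield"
  assumes "p \<noteq> 0" "q \<noteq> 0" "p \<le> c" "q \<le> c" "0 \<le> \<alpha>" "\<alpha> \<le> 1"
  shows "p rpow \<alpha> * q rpow (1 - \<alpha>) \<le> c"
proof -
  \<comment> \<open>The power laws are available only at nonzero bases; here c lies above p, which
    is nonzero.\<close>
  have "c \<noteq> 0"
    using assms by (auto simp: le_zero_idem)
  then have "p rpow \<alpha> * q rpow (1 - \<alpha>) \<le> c rpow \<alpha> * c rpow (1 - \<alpha>)"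
    using assms by (intro mult_mono_idem rpow_mono) auto
  also have "\<dots> = c"
    using \<open>c \<noteq> 0\<close> by (simp flip: rpow_add add: rpow_1)
  finally show ?thesis .
qed

section \<open>Irreducibility as a condition on index sets instead of orderings\<close>

lemma irreducible_matrix_closed_set:
  fixes A :: "'a::zero ^ 'n ^ 'n"
  assumes irr: "irreducible_matrix A"
    and zero: "\<And>i j. i \<in> Z \<Longrightarrow> j \<notin> Z \<Longrightarrow> A $ i $ j = 0"
  shows "Z = {} \<or> Z = UNIV"
proof (rule ccontr)
  assume nontriv: "\<not> (Z = {} \<or> Z = UNIV)"
  \<comment> \<open>The block required to vanish has rows from k on and columns below k, so the
    complement of Z is listed first and Z after it.\<close>
  define k where "k = card (- Z)"
  obtain f where f: "bij_betw f {..<k} (- Z)"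
    using ex_bij_betw_nat_finite[of "- Z"] by (auto simp: k_def lessThan_atLeast0)
  have card: "card Z + k = CARD('n)"
    using card_Un_disjoint[of Z "- Z"] by (simp add: k_def)
  then have "card {k..<CARD('n)} = card Z"
    by simp
  then obtain g where g: "bij_betw g {k..<CARD('n)} Z"
    using finite_same_card_bij[of "{k..<CARD('n)}" Z] by auto
  define \<pi> where "\<pi> i = (if i < k then f i else g i)" for i
  have "bij_betw \<pi> ({..<k} \<union> {k..<CARD('n)}) (- Z \<union> Z)"
  proof (rule bij_betw_combine)
    show "bij_betw \<pi> {..<k} (- Z)"
      using f by (rule bij_betw_cong[THEN iffD1, rotated]) (simp add: \<pi>_def)
    show "bij_betw \<pi> {k..<CARD('n)} Z"
      using g by (rule bij_betw_cong[THEN iffD1, rotated]) (simp add: \<pi>_def)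
  qed auto
  moreover have "{..<k} \<union> {k..<CARD('n)} = {..<CARD('n)}"
    using card by auto
  ultimately have bij: "bij_betw \<pi> {..<CARD('n)} (UNIV :: 'n set)"
    by simp
  have "0 < k"
    using nontriv by (auto simp: k_def card_gt_0_iff)
  moreover have "k < CARD('n)"
    using nontriv card by (metis card_gt_0_iff finite less_add_same_cancel2)
  moreover have "A $ \<pi> i $ \<pi> j = 0" if "k \<le> i" "i < CARD('n)" "j < k" for i j
  proof (rule zero)
    show "\<pi> i \<in> Z"
      using that bij_betwE[OF g] by (auto simp: \<pi>_def)
    show "\<pi> j \<notin> Z"
      using that bij_betwE[OF f] by (auto simp: \<pi>_def)
  qed
  ultimately have "block_triangular CARD('n) (\<lambda>i j. A $ \<pi> i $ \<pi> j)"
    unfolding block_triangular_def by blast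
  with irr bij show False
    unfolding irreducible_matrix_def by blast
qed

lemma irreducible_matrix_transpose:
  fixes A :: "'a::zero ^ 'n ^ 'n"
  assumes irr: "irreducible_matrix A"
  shows "irreducible_matrix (transpose A)"
  unfolding irreducible_matrix_def
proof (intro notI, elim exE conjE)
  fix \<pi> :: "nat \<Rightarrow> 'n"
  assume bij: "bij_betw \<pi> {..<CARD('n)} UNIV"
    and "block_triangular CARD('n) (\<lambda>i j. transpose A $ \<pi> i $ \<pi> j)"
  then obtain k where k: "0 < k" "k < CARD('n)"
    and zero: "\<And>i j. k \<le> i \<Longrightarrow> i < CARD('n) \<Longrightarrow> j < k \<Longrightarrow> A $ \<pi> j $ \<pi> i = 0"
    unfolding block_triangular_def by (auto simp: transpose_def)
  \<comment> \<open>A lower left zero block of the transpose is an upper right zero block of A, so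
    the first k indices now play the role of Z. Since 0 < k < n, they form a nontrivial set.\<close>
  have "\<pi> ` {..<k} = {} \<or> \<pi> ` {..<k} = UNIV"
  proof (rule irreducible_matrix_closed_set[OF irr])
    fix i j assume "i \<in> \<pi> ` {..<k}" and j: "j \<notin> \<pi> ` {..<k}"
    moreover obtain m where "m < CARD('n)" "j = \<pi> m"
      using bij by (metis UNIV_I bij_betw_def imageE lessThan_iff)
    ultimately show "A $ i $ j = 0"
      using zero by (metis image_iff lessThan_iff not_less)
  qed
  moreover have "card (\<pi> ` {..<k}) < CARD('n)"
    using card_image_le[of "{..<k}" \<pi>] k by simp
  ultimately show False
    using k by auto
qed

text \<open>If \<open>x $ i = 0\<close>, row i of the eigenvector equation is a sum equal to 0, and
  every term lies below it, hence vanishes. So the zero set of x is a set Z as in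
  \<open>irreducible_matrix_closed_set\<close>.\<close>

lemma irreducible_eigenvector_nonzero:
  fixes A :: "('a::idempotent_semifield) ^ 'n ^ 'n"
  assumes irr: "irreducible_matrix A" and eig: "eigenvector_for A x lam"
  shows "x \<in> nonzero_vectors"
proof -
  have Ax: "(\<Sum>j\<in>UNIV. A $ i $ j * x $ j) = lam * x $ i" for i
    using eig by (auto simp: eigenvector_for_def matrix_vector_mult_def vec_eq_iff)
  have "{i. x $ i = 0} = {} \<or> {i. x $ i = 0} = UNIV"
  proof (rule irreducible_matrix_closed_set[OF irr])
    fix i j assume ij: "i \<in> {i. x $ i = 0}" "j \<notin> {i. x $ i = 0}"
    then have "A $ i $ j * x $ j \<le> 0"
      using member_le_sum_idem[of UNIV j "\<lambda>j. A $ i $ j * x $ j"] Ax[of i] by simp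
    then show "A $ i $ j = 0"
      using ij by (simp add: le_zero_idem mult_eq_0_idem)
  qed
  moreover have "x \<noteq> 0"
    using eig by (simp add: eigenvector_for_def)
  ultimately show ?thesis
    by (auto simp: nonzero_vectors_def vec_eq_iff)
qed

section \<open>Pairing with a left eigenvector\<close>

lemma scalar_product_nonzero:
  fixes v x :: "('a::idempotent_semifield) ^ 'n"
  assumes "v \<in> nonzero_vectors" "x \<in> nonzero_vectors"
  shows "scalar_product v x \<noteq> 0"
proof
  assume "scalar_product v x = 0"
  then have "v $ i * x $ i = 0" for i
    using member_le_sum_idem[of UNIV i "\<lambda>i. v $ i * x $ i"]
    by (simp add: scalar_product_def le_zero_idem)
  with assms show False
    by (simp add: nonzero_vectors_def mult_eq_0_idem)
qed

lemma scalar_product_smult_right: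
  fixes v x :: "('a::comm_semiring_1) ^ 'n"
  shows "scalar_product v (c *s x) = c * scalar_product v x"
  by (simp add: scalar_product_def sum_distrib_left mult.left_commute)

text \<open>Interchanging the two sums moves A from x onto v, where its transpose acts as a
  scalar.\<close>

lemma scalar_product_left_eigenvector:
  fixes A :: "('a::comm_semiring_1) ^ 'n ^ 'n"
  assumes "eigenvector_for (transpose A) v lam"
  shows "scalar_product v (A *v x) = lam * scalar_product v x"
proof -
  have Av: "(\<Sum>i\<in>UNIV. A $ i $ j * v $ i) = lam * v $ j" for j
    using assms
    by (auto simp: eigenvector_for_def matrix_vector_mult_def vec_eq_iff transpose_def)
  have "scalar_product v (A *v x) = (\<Sum>i\<in>UNIV. \<Sum>j\<in>UNIV. A $ i $ j * v $ i * x $ j)"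
    by (simp add: scalar_product_def matrix_vector_mult_def sum_distrib_left mult_ac)
  also have "\<dots> = (\<Sum>j\<in>UNIV. (\<Sum>i\<in>UNIV. A $ i $ j * v $ i) * x $ j)"
    by (subst sum.swap) (simp add: sum_distrib_right)
  also have "\<dots> = lam * scalar_product v x"
    by (simp add: Av scalar_product_def sum_distrib_left mult.assoc)
  finally show ?thesis .
qed

lemma left_right_eigenvalue_eq:
  fixes A :: "('a::idempotent_semifield) ^ 'n ^ 'n"
  assumes "irreducible_matrix A"
    and "eigenvector_for A x lam" "eigenvector_for (transpose A) v mu"
  shows "lam = mu"
proof -
  have "scalar_product v x \<noteq> 0"
    using assms irreducible_matrix_transpose irreducible_eigenvector_nonzero
      scalar_product_nonzero by blast
  moreover have "mu * scalar_product v x = lam * scalar_product v x"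
    using assms scalar_product_left_eigenvector[of A v mu x]
    by (simp add: eigenvector_for_def scalar_product_smult_right)
  ultimately show ?thesis
    by (simp add: mult_right_cancel_idem)
qed

section \<open>Lower and upper bounds for the conjugate form\<close>

lemma conj_form_le_iff:
  fixes A :: "('a::idempotent_semifield) ^ 'n ^ 'n"
  assumes "x \<in> nonzero_vectors"
  shows "conj_form A x \<le> s \<longleftrightarrow> (\<forall>i j. A $ i $ j * x $ j \<le> s * x $ i)"
  \<comment> \<open>Bounding the double sum means bounding each term, and the invertible
    \<open>x $ i\<close> can be moved to the right. The lower bound takes s to be the form itself,
    the upper bound takes s = \<open>lam\<close>.\<close>
  using assms
  by (simp add: conj_form_def scalar_product_def conj_transpose_def matrix_vector_mult_def
      nonzero_vectors_def sum_le_iff_idem inverse_mult_le_iff_idem)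

lemma eigenvalue_le_conj_form:
  fixes A :: "('a::idempotent_semifield) ^ 'n ^ 'n"
  assumes eig: "eigenvector_for (transpose A) v lam"
    and v: "v \<in> nonzero_vectors" and x: "x \<in> nonzero_vectors"
  shows "lam \<le> conj_form A x"
proof -
  let ?s = "conj_form A x"
  have "\<forall>i j. A $ i $ j * x $ j \<le> ?s * x $ i"
    using conj_form_le_iff[OF x, of A ?s] by simp
  then have Ax: "(A *v x) $ i \<le> ?s * x $ i" for i
    by (simp add: matrix_vector_mult_def sum_le_iff_idem)
  have "lam * scalar_product v x = (\<Sum>i\<in>UNIV. v $ i * (A *v x) $ i)"
    using scalar_product_left_eigenvector[OF eig, of x] by (simp add: scalar_product_def)
  also have "\<dots> \<le> (\<Sum>i\<in>UNIV. v $ i * (?s *s x) $ i)"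
  proof (subst sum_le_iff_idem, simp, intro ballI)
    fix i
    have "v $ i * (A *v x) $ i \<le> v $ i * (?s *s x) $ i"
      using Ax by (simp add: mult_left_mono_idem)
    also have "\<dots> \<le> (\<Sum>i\<in>UNIV. v $ i * (?s *s x) $ i)"
      by (rule member_le_sum_idem) auto
    finally show "v $ i * (A *v x) $ i \<le> (\<Sum>i\<in>UNIV. v $ i * (?s *s x) $ i)" .
  qed
  also have "\<dots> = ?s * scalar_product v x"
    using scalar_product_smult_right[of v ?s x] by (simp add: scalar_product_def)
  finally show ?thesis
    using scalar_product_nonzero[OF v x] by (simp add: mult_le_cancel_right_idem)
qed

lemma eigenvector_entry_le:
  fixes A :: "('a::idempotent_semifield) ^ 'n ^ 'n"
  assumes "eigenvector_for A x lam"
  shows "A $ i $ j * x $ j \<le> lam * x $ i"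
proof -
  have "(\<Sum>j\<in>UNIV. A $ i $ j * x $ j) = lam * x $ i"
    using assms by (auto simp: eigenvector_for_def matrix_vector_mult_def vec_eq_iff)
  then show ?thesis
    using member_le_sum_idem[of UNIV j "\<lambda>j. A $ i $ j * x $ j"] by simp
qed

text \<open>The exponents are chosen so that \<open>inverse (x $ i) * A $ i $ j * x $ j\<close> is
  exactly the mean of p and q below with weights \<open>\<alpha>\<close> and
  \<open>1 - \<alpha>\<close>.\<close>

lemma conj_form_weighted_mean_le:
  fixes A :: "('a::real_power_semifield) ^ 'n ^ 'n"
  assumes u: "eigenvector_for A u lam" "u \<in> nonzero_vectors"
    and v: "eigenvector_for (transpose A) v lam" "v \<in> nonzero_vectors"
    and \<alpha>: "0 \<le> \<alpha>" "\<alpha> \<le> 1"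
    and x_def: "x = (\<chi> i. (u $ i) rpow \<alpha> * (v $ i) rpow (\<alpha> - 1))"
  shows "x \<in> nonzero_vectors \<and> conj_form A x \<le> lam"
proof
  have un: "u $ i \<noteq> 0" and vn: "v $ i \<noteq> 0" for i
    using u(2) v(2) by (auto simp: nonzero_vectors_def)
  show x: "x \<in> nonzero_vectors"
    by (simp add: nonzero_vectors_def x_def mult_eq_0_idem rpow_nonzero un vn)
  have "A $ i $ j * x $ j \<le> lam * x $ i" for i j
  \<comment> \<open>A zero entry is treated apart because it would make p and q zero, where the
    power laws do not apply.\<close>
  proof (cases "A $ i $ j = 0")
    case True
    then show ?thesis by (simp add: zero_le_idem)
  next
    case False
    define a where "a = A $ i $ j"
    have a: "a \<noteq> 0" using False by (simp add: a_def)
    define p where "p = inverse (u $ i) * (a * u $ j)"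
    \<comment> \<open>The indices are reversed: the bound on q is the entry (j, i) of the transposed
      eigenvector equation.\<close>
    define q where "q = inverse (v $ j) * (a * v $ i)"
    have "p \<le> lam"
      using eigenvector_entry_le[OF u(1), of i j]
      by (simp add: p_def a_def inverse_mult_le_iff_idem un)
    moreover have "q \<le> lam"
      using eigenvector_entry_le[OF v(1), of j i]
      by (simp add: q_def a_def inverse_mult_le_iff_idem vn transpose_def)
    moreover have "p \<noteq> 0" "q \<noteq> 0"
      by (simp_all add: p_def q_def mult_eq_0_idem inverse_nonzero_idem un vn a)
    ultimately have le: "p rpow \<alpha> * q rpow (1 - \<alpha>) \<le> lam"
      using \<alpha> by (intro weighted_mean_le)
    have p_pow: "p rpow \<alpha> = (u $ i) rpow (- \<alpha>) * (a rpow \<alpha> * (u $ j) rpow \<alpha>)"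
      by (simp add: p_def rpow_mult_base mult_eq_0_idem inverse_nonzero_idem un a rpow_minus)
    have q_pow: "q rpow (1 - \<alpha>)
        = (v $ j) rpow (\<alpha> - 1) * (a rpow (1 - \<alpha>) * (v $ i) rpow (1 - \<alpha>))"
      using rpow_minus[OF vn, of j "1 - \<alpha>"]
      by (simp add: q_def rpow_mult_base mult_eq_0_idem inverse_nonzero_idem vn a)
    have cancel: "(u $ i) rpow (- \<alpha>) * (u $ i) rpow \<alpha> = 1"
      "(v $ i) rpow (1 - \<alpha>) * (v $ i) rpow (\<alpha> - 1) = 1"
      by (simp_all flip: rpow_add add: rpow_0 un vn)
    have a_pow: "a rpow \<alpha> * a rpow (1 - \<alpha>) = a"
      by (simp flip: rpow_add add: rpow_1 a)
    \<comment> \<open>Multiplying by \<open>x $ i\<close> cancels the powers of \<open>u $ i\<close>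
      and \<open>v $ i\<close>, and the two powers of a recombine to a.\<close>
    have "p rpow \<alpha> * q rpow (1 - \<alpha>) * x $ i
      = (a rpow \<alpha> * a rpow (1 - \<alpha>)) * ((u $ i) rpow (- \<alpha>) * (u $ i) rpow \<alpha>)
        * ((v $ i) rpow (1 - \<alpha>) * (v $ i) rpow (\<alpha> - 1)) * x $ j"
      by (simp add: p_pow q_pow x_def mult_ac)
    also have "\<dots> = A $ i $ j * x $ j"
      unfolding cancel a_pow by (simp add: a_def)
    finally show ?thesis
      using mult_mono_idem[OF le order_refl, of "x $ i"] by simp
  qed
  then show "conj_form A x \<le> lam"
    using conj_form_le_iff[OF x] by blast
qed

theorem lemma1:
  fixes A :: "('a::real_power_semifield) ^ 'n ^ 'n"
    and u v :: "'a ^ 'n"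
    and lam :: 'a
  assumes "irreducible_matrix A"
    and "eigenvalue_of A lam"
    and "eigenvector_of A u"
    and "eigenvector_of (transpose A) v"
  shows "minimum_on (conj_form A) nonzero_vectors lam \<and>
    (\<forall>\<alpha>::real. 0 \<le> \<alpha> \<and> \<alpha> \<le> 1 \<longrightarrow>
      attains_at (conj_form A) nonzero_vectors lam
        (\<chi> i. (u $ i) rpow \<alpha> * (v $ i) rpow (\<alpha> - 1)))"
proof -
  obtain w lam' mu where w: "eigenvector_for A w lam"
    and u: "eigenvector_for A u lam'" and v: "eigenvector_for (transpose A) v mu"
    using assms by (auto simp: eigenvalue_of_def eigenvector_of_def)
  \<comment> \<open>The eigenvalues of u and w are both compared with the single left eigenvalue
    \<open>mu\<close>.\<close>
  have "lam' = lam" "mu = lam"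
    using left_right_eigenvalue_eq[OF assms(1) _ v] w u by auto
  note u = u[unfolded this] and v = v[unfolded this]
  have un: "u \<in> nonzero_vectors" and vn: "v \<in> nonzero_vectors"
    using assms(1) u v irreducible_matrix_transpose irreducible_eigenvector_nonzero by blast+
  note lower = eigenvalue_le_conj_form[OF v vn]
  have attain: "attains_at (conj_form A) nonzero_vectors lam
        (\<chi> i. (u $ i) rpow \<alpha> * (v $ i) rpow (\<alpha> - 1))" if "0 \<le> \<alpha>" "\<alpha> \<le> 1" for \<alpha> :: real
    using conj_form_weighted_mean_le[OF u un v vn that refl] lower
    by (auto simp: attains_at_def intro: antisym)
  moreover have "minimum_on (conj_form A) nonzero_vectors lam"
    \<comment> \<open>Any exponent in [0, 1] supplies a minimizer; the choice 1 amounts to x =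
      u.\<close>
    unfolding minimum_on_def using lower attain[of 1] by auto
  ultimately show ?thesis
    by blast
qed

end
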